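(* Let $d=2$, let $f(x_1,x_2)$ be an entire function of order $\rho=\rho(f)<\frac12$, and let $ax_1=x_2^2$ (with $a$ a non-zero real number) define the locus of a parabola. Then there exists an entire harmonic function $h$ of order $\le\rho$ such that $h=f$ on $\Omega:=\{(x_1,x_2)\in\mathbb{R}^2:ax_1=x_2^2\}$.
   Context: An entire function is a holomorphic function $f:\mathbb{C}^2\to\mathbb{C}$, also viewed as a function on $\mathbb{R}^2$ by restriction. It is called harmonic if $\Delta h=\partial^2h/\partial x_1^2+\partial^2h/\partial x_2^2=0$. Order: with $\mathbb{S}^1=\{\theta\in\mathbb{R}^2:|\theta|=1\}$ and, for $r>0$, $M(f,r)=\sup\{|f(\zeta\theta)|:\zeta\in\mathbb{C},|\zeta|=r,\theta\in\mathbb{S}^1\}$, the order of a non-constant entire function $f$ is $\rho(f)=\limsup_{r\to\infty}\frac{\log\log M(f,r)}{\log r}\in[0,\infty]$; constant functions are regarded as having order $0$. (The same order results if $M(f,r)$ is replaced by $\sup\{|f(z)|:z\in\mathbb{C}^2,|z|=r\}$.) *)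

theory Defs
  imports "HOL-Complex_Analysis.Complex_Analysis"
begin

text \<open>
  Holomorphic functions on the whole of \<open>\<complex>\<^sup>2\<close>: at every point there is a Frechet derivative that is
  complex linear, i.e. of the form \<open>(u, v) \<mapsto> a * u + b * v\<close>.
\<close>

definition entire2 :: "(complex \<times> complex \<Rightarrow> complex) \<Rightarrow> bool" where
  "entire2 f \<longleftrightarrow>
     (\<forall>z. \<exists>a b. (f has_derivative (\<lambda>v. a * fst v + b * snd v)) (at z))"

text \<open>
  The second partial derivatives are complex ones, so at real points of an entire function they are
  the usual second partial derivatives of its restriction to \<open>\<real>\<^sup>2\<close>.
\<close>

definition laplacian2 :: "(complex \<times> complex \<Rightarrow> complex) \<Rightarrow> complex \<times> complex \<Rightarrow> complex" where
  "laplacian2 f z =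
     (deriv ^^ 2) (\<lambda>t. f (t, snd z)) (fst z) + (deriv ^^ 2) (\<lambda>t. f (fst z, t)) (snd z)"

definition entire_harmonic2 :: "(complex \<times> complex \<Rightarrow> complex) \<Rightarrow> bool" where
  "entire_harmonic2 h \<longleftrightarrow> entire2 h \<and> (\<forall>z. laplacian2 h z = 0)"

definition max_modulus2 :: "(complex \<times> complex \<Rightarrow> complex) \<Rightarrow> real \<Rightarrow> real" where
  "max_modulus2 f r =
     (SUP (\<zeta>, \<theta>) \<in> sphere (0 :: complex) r \<times> sphere (0 :: real \<times> real) 1.
        cmod (f (\<zeta> * of_real (fst \<theta>), \<zeta> * of_real (snd \<theta>))))"

text \<open>
  For entire \<open>f\<close> the supremum above is over a bounded set, and for non-constant entire \<open>f\<close> it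
  tends to infinity, so only arguments where both logarithms are genuine affect the upper limit.
\<close>

definition growth_order2 :: "(complex \<times> complex \<Rightarrow> complex) \<Rightarrow> ereal" where
  "growth_order2 f =
     (if f constant_on UNIV then 0
      else Limsup at_top (\<lambda>r. ereal (ln (ln (max_modulus2 f r)) / ln r)))"

definition parabola :: "real \<Rightarrow> (real \<times> real) set" where
  "parabola a = {(x1, x2). a * x1 = x2\<^sup>2}"

end

theory Submission
  imports Defs
begin

text \<open>
  In the coordinates \<open>x\<^sub>1 \<plusminus> \<i> x\<^sub>2\<close> every entire harmonic function is a sum of two entire functions of
  one variable, and on the parabola both coordinates become, after an affine substitution, squares
  of \<open>s \<plusminus> \<i>/2\<close>.  Interpolating \<open>f\<close> there thus amounts to solving \<open>D (u + \<i>) - D (u - \<i>) = K u\<close>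
  for a given odd \<open>K\<close> of order at most \<open>2 \<rho> < 1\<close>.  The operator \<open>\<partial> / (2 \<i> sin \<partial>)\<close> applied to an
  antiderivative of \<open>K\<close> converges, because functions of order less than \<open>1\<close> have exponential type
  zero, and it preserves the order; passing back from \<open>u\<close> to \<open>u\<^sup>2\<close> halves it.
\<close>

subsection \<open>Power-exponential growth\<close>

text \<open>The bound is required for all \<open>z\<close>. Since \<open>1 + norm z\<close> is at
  least 1, constant factors can be absorbed into \<open>c\<close> when
  \<open>\<sigma> \<ge> 0\<close>. An entire function has order at most \<rho> exactly when this
  holds for every exponent above \<rho>.\<close>

definition growth_le :: "real \<Rightarrow> ('a::real_normed_vector \<Rightarrow> complex) \<Rightarrow> bool" where
  "growth_le \<sigma> F \<longleftrightarrow> (\<exists>c. \<forall>z. norm (F z) \<le> exp (c * (1 + norm z) powr \<sigma>))"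

lemma growth_leI:
  assumes "\<And>z. norm (F z) \<le> exp (c * (1 + norm z) powr \<sigma>)"
  shows "growth_le \<sigma> F"
  using assms unfolding growth_le_def by blast

lemma growth_leE:
  assumes "growth_le \<sigma> F"
  obtains c where "c \<ge> 1" "\<And>z. norm (F z) \<le> exp (c * (1 + norm z) powr \<sigma>)"
proof -
  from assms obtain c where c: "norm (F z) \<le> exp (c * (1 + norm z) powr \<sigma>)" for z
    unfolding growth_le_def by blast
  have "norm (F z) \<le> exp (max c 1 * (1 + norm z) powr \<sigma>)" for z
  proof -
    have "c * (1 + norm z) powr \<sigma> \<le> max c 1 * (1 + norm z) powr \<sigma>"
      by (intro mult_right_mono) auto
    with c[of z] show ?thesis
      by (meson exp_le_cancel_iff order_trans)
  qed
  thus ?thesis by (intro that[of "max c 1"]) auto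
qed

lemma growth_le_mono:
  assumes "growth_le \<sigma> G" "\<And>z. norm (F z) \<le> norm (G z)"
  shows "growth_le \<sigma> F"
  using assms unfolding growth_le_def by (meson order_trans)

lemma growth_le_const:
  assumes "\<sigma> \<ge> 0"
  shows "growth_le \<sigma> (\<lambda>_. k)"
proof (rule growth_leI)
  fix z :: 'a
  have "norm k \<le> exp (norm k)"
    using exp_ge_add_one_self[of "norm k"] by linarith
  also have "\<dots> \<le> exp (norm k * (1 + norm z) powr \<sigma>)"
    using ge_one_powr_ge_zero[of "1 + norm z" \<sigma>] assms
    by (simp add: mult_le_cancel_left1)
  finally show "norm k \<le> exp (norm k * (1 + norm z) powr \<sigma>)" .
qed

lemma growth_le_ident:
  assumes "\<sigma> > 0"
  shows "growth_le \<sigma> (\<lambda>z :: complex. z)"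
proof (rule growth_leI)
  fix z :: complex
  have "ln (1 + norm z) \<le> (1 + norm z) powr \<sigma> / \<sigma>"
    using assms by (intro ln_powr_bound) auto
  hence "exp (ln (1 + norm z)) \<le> exp (1 / \<sigma> * (1 + norm z) powr \<sigma>)"
    by simp
  moreover have "exp (ln (1 + norm z)) = 1 + norm z"
    by (intro exp_ln) (simp add: add_pos_nonneg)
  ultimately show "norm z \<le> exp (1 / \<sigma> * (1 + norm z) powr \<sigma>)"
    by linarith
qed

lemma growth_le_mult:
  assumes "growth_le \<sigma> F" "growth_le \<sigma> G"
  shows "growth_le \<sigma> (\<lambda>z. F z * G z)"
proof -
  from assms obtain c d where
    c: "\<And>z. norm (F z) \<le> exp (c * (1 + norm z) powr \<sigma>)" and
    d: "\<And>z. norm (G z) \<le> exp (d * (1 + norm z) powr \<sigma>)"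
    by (metis growth_leE)
  show ?thesis
    by (rule growth_leI[of _ "c + d"])
       (use mult_mono[OF c d] in \<open>simp add: norm_mult distrib_right exp_add\<close>)
qed

lemma growth_le_add:
  fixes F G :: "'a::real_normed_vector \<Rightarrow> complex"
  assumes "growth_le \<sigma> F" "growth_le \<sigma> G" "\<sigma> \<ge> 0"
  shows "growth_le \<sigma> (\<lambda>z. F z + G z)"
proof -
  from assms obtain c d where cd: "c \<ge> 1" "d \<ge> 1" and
    c: "\<And>z. norm (F z) \<le> exp (c * (1 + norm z) powr \<sigma>)" and
    d: "\<And>z. norm (G z) \<le> exp (d * (1 + norm z) powr \<sigma>)"
    by (metis growth_leE)
  show ?thesis
  proof (rule growth_leI)
    fix z :: 'a
    define x where "x = (1 + norm z) powr \<sigma>"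
    have x: "x \<ge> 1"
      unfolding x_def by (intro ge_one_powr_ge_zero) (use assms in auto)
    have "norm (F z + G z) \<le> exp (c * x) + exp (d * x)"
      unfolding x_def by (intro norm_triangle_le add_mono c d)
    \<comment> \<open>Both exponentials are at least 1, so each is at most their product. The factor
      2 is then absorbed by \<open>exp x\<close>, because \<open>x \<ge> 1\<close>.\<close>
    also have "\<dots> \<le> 2 * (exp (c * x) * exp (d * x))"
    proof -
      have "exp (c * x) \<ge> 1" "exp (d * x) \<ge> 1" using cd x by auto
      hence "exp (c * x) \<le> exp (c * x) * exp (d * x)" "exp (d * x) \<le> exp (c * x) * exp (d * x)"
        by (simp_all add: mult_le_cancel_left1 mult_le_cancel_right1)
      thus ?thesis by linarith
    qed
    also have "\<dots> \<le> exp x * (exp (c * x) * exp (d * x))"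
      using exp_ge_add_one_self[of x] x by (intro mult_right_mono mult_nonneg_nonneg exp_ge_zero) linarith
    also have "\<dots> = exp ((1 + c + d) * x)"
      by (simp add: exp_add algebra_simps)
    finally show "norm (F z + G z) \<le> exp ((1 + c + d) * (1 + norm z) powr \<sigma>)"
      unfolding x_def .
  qed
qed

lemma growth_le_uminus: "growth_le \<sigma> F \<Longrightarrow> growth_le \<sigma> (\<lambda>z. - F z)"
  by (erule growth_le_mono) simp

lemma growth_le_diff:
  assumes "growth_le \<sigma> F" "growth_le \<sigma> G" "\<sigma> \<ge> 0"
  shows "growth_le \<sigma> (\<lambda>z. F z - G z)"
  using growth_le_add[OF assms(1) growth_le_uminus[OF assms(2)] assms(3)] by simp

text \<open>A substitution of growth degree \<open>k\<close> multiplies the exponent by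
  \<open>k\<close>. The case \<open>k = 2\<close> serves the parametrised parabola,
  \<open>k = 1 / 2\<close> the square root, and \<open>k = 1\<close> affine maps.\<close>

lemma growth_le_compose:
  assumes "growth_le \<sigma> F" "\<sigma> \<ge> 0" "A \<ge> 0"
    and p: "\<And>z. 1 + norm (p z) \<le> A * (1 + norm z) powr k"
  shows "growth_le (k * \<sigma>) (\<lambda>z. F (p z))"
proof -
  from assms obtain c where c: "c \<ge> 1" "\<And>z. norm (F z) \<le> exp (c * (1 + norm z) powr \<sigma>)"
    by (metis growth_leE)
  show ?thesis
  proof (rule growth_leI)
    fix z
    have "(1 + norm (p z)) powr \<sigma> \<le> (A * (1 + norm z) powr k) powr \<sigma>"
      by (intro powr_mono2 p) (use assms in auto)
    also have "\<dots> = A powr \<sigma> * (1 + norm z) powr (k * \<sigma>)"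
      using assms by (simp add: powr_mult powr_powr)
    finally have "c * (1 + norm (p z)) powr \<sigma> \<le> (c * A powr \<sigma>) * (1 + norm z) powr (k * \<sigma>)"
      using c(1) by simp
    with c(2)[of "p z"] show "norm (F (p z)) \<le> exp ((c * A powr \<sigma>) * (1 + norm z) powr (k * \<sigma>))"
      by (meson exp_le_cancel_iff order_trans)
  qed
qed

lemma growth_le_compose_linear:
  assumes "growth_le \<sigma> F" "\<sigma> \<ge> 0" "A \<ge> 0"
    and p: "\<And>z. 1 + norm (p z) \<le> A * (1 + norm z)"
  shows "growth_le \<sigma> (\<lambda>z. F (p z))"
proof -
  have "1 + norm (p z) \<le> A * (1 + norm z) powr 1" for z
    using p[of z] by simp
  from growth_le_compose[OF assms(1-3) this] show ?thesis by simp
qed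

text \<open>The bound on \<open>K\<close> increases with \<open>norm z\<close>, so the mean value
  inequality on the disc of that radius costs only a factor \<open>z\<close>, which is harmless for
  positive exponents. A single \<open>G\<close> serves all \<open>\<sigma>\<close>, so no exponent
  is lost later.\<close>

lemma entire_antiderivative:
  fixes K :: "complex \<Rightarrow> complex"
  assumes "K holomorphic_on UNIV"
  obtains G where "\<And>z. (G has_field_derivative K z) (at z)"
    "\<And>\<sigma>. \<sigma> > 0 \<Longrightarrow> growth_le \<sigma> K \<Longrightarrow> growth_le \<sigma> G"
proof -
  obtain G where G: "\<And>z. (G has_field_derivative K z) (at z)"
    using holomorphic_convex_primitive'[of UNIV K] assms by auto
  have "growth_le \<sigma> G" if \<sigma>: "\<sigma> > 0" and K: "growth_le \<sigma> K" for \<sigma>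
  proof -
    from K obtain c where c: "c \<ge> 1" "\<And>z. norm (K z) \<le> exp (c * (1 + norm z) powr \<sigma>)"
      by (metis growth_leE)
    define E where "E = (\<lambda>z::complex. complex_of_real (exp (c * (1 + norm z) powr \<sigma>)))"
    have E: "growth_le \<sigma> E"
      by (rule growth_leI[of _ c]) (simp add: E_def)
    have "norm (G z - G 0) \<le> norm (E z * z)" for z
    proof -
      have "norm (K w) \<le> exp (c * (1 + norm z) powr \<sigma>)" if "w \<in> cball 0 (norm z)" for w
      proof -
        have "(1 + norm w) powr \<sigma> \<le> (1 + norm z) powr \<sigma>"
          using that \<sigma> by (intro powr_mono2) auto
        thus ?thesis
          using c(1) c(2)[of w] by (smt (verit) exp_le_cancel_iff mult_left_mono)
      qed
      hence "norm (G z - G 0) \<le> exp (c * (1 + norm z) powr \<sigma>) * norm (z - 0)"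
        by (intro field_differentiable_bound[OF convex_cball[of 0 "norm z"], where f' = K])
           (use G in \<open>auto intro: has_field_derivative_at_within\<close>)
      thus ?thesis by (simp add: E_def norm_mult)
    qed
    hence "growth_le \<sigma> (\<lambda>z. G z - G 0)"
      by (rule growth_le_mono[OF growth_le_mult[OF E growth_le_ident[OF \<sigma>]]])
    from growth_le_add[OF this growth_le_const[of \<sigma> "G 0"]] \<sigma> show ?thesis
      by simp
  qed
  with G show ?thesis using that by blast
qed

text \<open>The witness is \<open>F \<circ> csqrt\<close>; its power series shows that it is holomorphic across the branch
  cut.\<close>

lemma even_entire:
  fixes F :: "complex \<Rightarrow> complex"
  assumes hol: "F holomorphic_on UNIV" and even: "\<And>z. F (- z) = F z"
  obtains g where "g holomorphic_on UNIV" "\<And>z. F z = g (z\<^sup>2)"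
    "\<And>\<sigma>. \<sigma> \<ge> 0 \<Longrightarrow> growth_le \<sigma> F \<Longrightarrow> growth_le (\<sigma> / 2) g"
proof -
  define a where "a = (\<lambda>n. (deriv ^^ n) F 0 / fact n)"
  have sums: "(\<lambda>n. a n * z ^ n) sums F z" for z
  proof -
    have "F holomorphic_on ball 0 (norm z + 1)"
      using hol holomorphic_on_subset by blast
    from holomorphic_power_series[OF this, of z] show ?thesis
      by (simp add: a_def)
  qed
  define g where "g = (\<lambda>w. F (csqrt w))"
  have g: "(\<lambda>n. a (2 * n) * w ^ n) sums g w" for w
  proof -
    define z where "z = csqrt w"
    \<comment> \<open>Averaging the series at \<open>z\<close> and \<open>- z\<close> removes the
      odd powers; what remains is a power series in \<open>z\<^sup>2 = w\<close>.\<close>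
    have "(\<lambda>n. (a n * z ^ n + a n * (- z) ^ n) / 2) sums ((F z + F (- z)) / 2)"
      by (intro sums_divide sums_add sums)
    moreover have "(F z + F (- z)) / 2 = F z" using even by simp
    ultimately have "(\<lambda>n. (a n * z ^ n + a n * (- z) ^ n) / 2) sums F z" by simp
    moreover have "(a n * z ^ n + a n * (- z) ^ n) / 2 = 0" if "n \<notin> range ((*) 2)" for n
    proof -
      from that have "odd n" by (auto elim: evenE)
      thus ?thesis by (simp add: power_minus_odd)
    qed
    ultimately have "(\<lambda>n. (a (2 * n) * z ^ (2 * n) + a (2 * n) * (- z) ^ (2 * n)) / 2) sums F z"
      by (subst sums_mono_reindex[where g = "(*) 2" and
            f = "\<lambda>n. (a n * z ^ n + a n * (- z) ^ n) / 2"]) (auto intro!: strict_monoI)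
    moreover have "z ^ (2 * n) = w ^ n" for n
      by (simp add: z_def power_mult)
    ultimately show ?thesis
      by (simp add: g_def z_def power_minus_even)
  qed
  have "g holomorphic_on UNIV"
  proof -
    have "g holomorphic_on ball 0 r" for r
      using power_series_holomorphic[of 0 r "\<lambda>n. a (2 * n)" g] g by simp
    hence "g holomorphic_on (\<Union>r. ball 0 r)"
      by (intro holomorphic_on_UN_open) auto
    also have "(\<Union>r. ball 0 r) = (UNIV :: complex set)"
      by (auto intro: gt_ex)
    finally show ?thesis .
  qed
  moreover have "F z = g (z\<^sup>2)" for z
  proof -
    have "csqrt (z\<^sup>2) = z \<or> csqrt (z\<^sup>2) = - z"
      by (metis power2_csqrt power2_eq_iff)
    thus ?thesis using even unfolding g_def by metis
  qed
  moreover have "growth_le (\<sigma> / 2) g" if "\<sigma> \<ge> 0" "growth_le \<sigma> F" for \<sigma>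
  proof -
    have "1 + norm (csqrt z) \<le> 2 * (1 + norm z) powr (1 / 2)" for z
    proof -
      have "sqrt (norm z) \<le> sqrt (1 + norm z)" "1 \<le> sqrt (1 + norm z)" by auto
      hence "1 + sqrt (norm z) \<le> 2 * sqrt (1 + norm z)" by linarith
      thus ?thesis by (simp add: powr_half_sqrt)
    qed
    from growth_le_compose[OF that(2,1) _ this] show ?thesis
      by (simp add: g_def)
  qed
  ultimately show ?thesis using that by blast
qed

subsection \<open>Maximum modulus and order in two variables\<close>

lemma entire2_compose:
  assumes f: "entire2 f"
    and p: "\<And>t. (p has_field_derivative p' t) (at t)"
    and q: "\<And>t. (q has_field_derivative q' t) (at t)"
  shows "(\<lambda>t. f (p t, q t)) holomorphic_on UNIV"
proof -
  have "\<exists>D. ((\<lambda>t. f (p t, q t)) has_field_derivative D) (at t)" for t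
  proof -
    from f obtain a b where "(f has_derivative (\<lambda>v. a * fst v + b * snd v)) (at (p t, q t))"
      unfolding entire2_def by blast
    moreover have "((\<lambda>t. (p t, q t)) has_derivative (\<lambda>h. (p' t * h, q' t * h))) (at t)"
      using p[of t] q[of t] unfolding has_field_derivative_def
      by (intro has_derivative_Pair) simp_all
    ultimately have "((\<lambda>t. f (p t, q t)) has_derivative
        (\<lambda>h. a * fst (p' t * h, q' t * h) + b * snd (p' t * h, q' t * h))) (at t)"
      using has_derivative_compose by fast
    also have "(\<lambda>h. a * fst (p' t * h, q' t * h) + b * snd (p' t * h, q' t * h)) =
        (*) (a * p' t + b * q' t)"
      by (auto simp: fun_eq_iff algebra_simps)
    finally have "((\<lambda>t. f (p t, q t)) has_field_derivative (a * p' t + b * q' t)) (at t)"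
      unfolding has_field_derivative_def .
    thus ?thesis by blast
  qed
  thus ?thesis
    by (simp add: holomorphic_on_def field_differentiable_def)
qed

lemma entire2_compose_affine:
  assumes "entire2 f"
  shows "(\<lambda>t. f (a + b * t, c + d * t)) holomorphic_on UNIV"
  by (rule entire2_compose[OF assms, where p' = "\<lambda>_. b" and q' = "\<lambda>_. d"])
     (auto intro!: derivative_eq_intros)

lemma entire2_continuous_on: "entire2 f \<Longrightarrow> continuous_on S f"
  unfolding entire2_def
  by (metis continuous_at_imp_continuous_on has_derivative_continuous)

lemma norm_le_max_modulus2:
  assumes f: "entire2 f" and "norm \<zeta> = r" "norm \<theta> = 1"
  shows "norm (f (\<zeta> * of_real (fst \<theta>), \<zeta> * of_real (snd \<theta>))) \<le> max_modulus2 f r"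
proof -
  let ?S = "sphere (0::complex) r \<times> sphere (0 :: real \<times> real) 1"
  let ?g = "\<lambda>(\<zeta>, \<theta>). cmod (f (\<zeta> * of_real (fst \<theta>), \<zeta> * of_real (snd \<theta>)))"
  have "continuous_on ?S ?g"
    unfolding case_prod_unfold
    by (intro continuous_on_norm continuous_on_compose2[OF entire2_continuous_on[OF f, of UNIV]]
        continuous_intros) auto
  hence "compact (?g ` ?S)"
    by (intro compact_continuous_image compact_Times compact_sphere)
  hence bdd: "bdd_above (?g ` ?S)"
    by (intro bounded_imp_bdd_above compact_imp_bounded)
  have "?g (\<zeta>, \<theta>) \<le> max_modulus2 f r"
    unfolding max_modulus2_def using assms by (intro cSUP_upper bdd) auto
  thus ?thesis by simp
qed

lemma max_modulus2_le:
  assumes "r \<ge> 0" "\<And>z. norm z = r \<Longrightarrow> norm (f z) \<le> B"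
  shows "max_modulus2 f r \<le> B"
  unfolding max_modulus2_def
proof (rule cSUP_least)
  have "complex_of_real r \<in> sphere 0 r" "(1, 0) \<in> sphere (0 :: real \<times> real) 1"
    using assms(1) by (auto simp: norm_Pair)
  thus "sphere (0::complex) r \<times> sphere (0 :: real \<times> real) 1 \<noteq> {}" by blast
next
  fix x :: "complex \<times> (real \<times> real)"
  assume x: "x \<in> sphere 0 r \<times> sphere 0 1"
  obtain \<zeta> s t where [simp]: "x = (\<zeta>, s, t)" by (cases x) auto
  from x have "norm \<zeta> = r" "s\<^sup>2 + t\<^sup>2 = 1" by (auto simp: norm_Pair real_sqrt_eq_1_iff)
  hence "norm (\<zeta> * of_real s, \<zeta> * of_real t) = r"
    using assms(1)
    by (simp add: norm_Pair norm_mult power_mult_distrib flip: distrib_left)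
  thus "(case x of (\<zeta>, \<theta>) \<Rightarrow> cmod (f (\<zeta> * of_real (fst \<theta>), \<zeta> * of_real (snd \<theta>)))) \<le> B"
    using assms(2) by simp
qed

text \<open>In the coordinates \<open>u = x\<^sub>1 + \<i> x\<^sub>2\<close>, \<open>v = x\<^sub>1 - \<i> x\<^sub>2\<close> the points \<open>\<zeta> \<theta>\<close> with
  \<open>|\<zeta>| = r\<close> and \<open>\<theta>\<close> on the real unit circle form exactly the torus \<open>|u| = |v| = r\<close>, so the
  maximum principle extends the bound to the bidisc.\<close>

lemma torus_le_max_modulus2:
  assumes f: "entire2 f" and "norm u = r" "norm v = r"
  shows "norm (f ((u + v) / 2, (u - v) / (2 * \<i>))) \<le> max_modulus2 f r"
proof (cases "r = 0")
  case True
  with assms norm_le_max_modulus2[OF f, of 0 0 "(1, 0)"] show ?thesis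
    by (simp add: norm_Pair)
next
  case False
  \<comment> \<open>With \<open>\<zeta>\<^sup>2 = u * v\<close> the quotient
    \<open>w = u / \<zeta>\<close> is unimodular, \<open>u = \<zeta> * w\<close> and
    \<open>v = \<zeta> * cnj w\<close>. Hence the required real direction is
    \<open>(Re w, Im w)\<close>.\<close>
  define \<zeta> where "\<zeta> = csqrt (u * v)"
  have \<zeta>2: "\<zeta>\<^sup>2 = u * v" by (simp add: \<zeta>_def)
  have r: "r > 0" using False assms by auto
  have "(norm \<zeta>)\<^sup>2 = r\<^sup>2"
    using \<zeta>2 assms by (metis norm_mult norm_power power2_eq_square)
  hence n\<zeta>: "norm \<zeta> = r" using r by (simp add: power2_eq_iff_nonneg)
  hence \<zeta>0: "\<zeta> \<noteq> 0" using r by auto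
  define w where "w = u / \<zeta>"
  have nw: "norm w = 1" using n\<zeta> assms r by (simp add: w_def norm_divide)
  hence w0: "w \<noteq> 0" by auto
  have u: "u = \<zeta> * w" using \<zeta>0 by (simp add: w_def)
  have "\<zeta> * \<zeta> = \<zeta> * w * v" using \<zeta>2 u by (simp add: power2_eq_square)
  hence "\<zeta> = w * v" using \<zeta>0 by simp
  hence v: "v = \<zeta> * cnj w"
    using nw by (simp add: mult.commute mult.left_commute complex_norm_square[symmetric] flip: mult.assoc)
  have 1: "(u + v) / 2 = \<zeta> * of_real (Re w)"
    unfolding u v by (simp add: complex_add_cnj flip: distrib_left)
  have 2: "(u - v) / (2 * \<i>) = \<zeta> * of_real (Im w)"
    unfolding u v by (simp add: complex_diff_cnj field_simps flip: right_diff_distrib)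
  have "norm (Re w, Im w) = 1"
    using nw by (simp add: norm_Pair cmod_def)
  from norm_le_max_modulus2[OF f n\<zeta> this] show ?thesis
    unfolding 1 2 by simp
qed

lemma maximum_modulus_disc:
  assumes "F holomorphic_on UNIV" "\<And>z. norm z = r \<Longrightarrow> norm (F z) \<le> B" "norm w \<le> r"
  shows "norm (F w) \<le> B"
proof (rule maximum_modulus_frontier[of F "cball 0 r"])
  show "F holomorphic_on interior (cball 0 r)"
    using assms(1) holomorphic_on_subset by blast
  show "continuous_on (closure (cball 0 r)) F"
    using assms(1) holomorphic_on_imp_continuous_on holomorphic_on_subset by blast
qed (use assms in auto)

lemma bidisc_le_max_modulus2:
  assumes f: "entire2 f" and "norm (z1 + \<i> * z2) \<le> r" "norm (z1 - \<i> * z2) \<le> r"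
  shows "norm (f (z1, z2)) \<le> max_modulus2 f r"
proof -
  define g where "g = (\<lambda>u v. f ((u + v) / 2, (u - v) / (2 * \<i>)))"
  have hol1: "(\<lambda>u. g u v) holomorphic_on UNIV" for v
    using entire2_compose_affine[OF f, of "v / 2" "1 / 2" "- v / (2 * \<i>)" "1 / (2 * \<i>)"]
    by (simp add: g_def field_simps)
  have hol2: "(\<lambda>v. g u v) holomorphic_on UNIV" for u
    using entire2_compose_affine[OF f, of "u / 2" "1 / 2" "u / (2 * \<i>)" "- 1 / (2 * \<i>)"]
    by (simp add: g_def field_simps)
  \<comment> \<open>The maximum principle is applied in one variable at a time: first in
    \<open>v\<close> with \<open>u\<close> on the circle, then in \<open>u\<close> with
    \<open>v\<close> anywhere in the disc.\<close>
  have "norm (g u v) \<le> max_modulus2 f r" if "norm u = r" "norm v \<le> r" for u v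
    by (rule maximum_modulus_disc[OF hol2 _ that(2)])
       (use torus_le_max_modulus2[OF f that(1)] in \<open>auto simp: g_def\<close>)
  hence "norm (g u v) \<le> max_modulus2 f r" if "norm u \<le> r" "norm v \<le> r" for u v
    using maximum_modulus_disc[OF hol1 _ that(1)] that(2) by blast
  from this[OF assms(2,3)] show ?thesis
    by (simp add: g_def field_simps)
qed

text \<open>The ball of radius \<open>r / 2\<close> lies in the bidisc, as both coordinates have
  modulus at most \<open>norm z1 + norm z2\<close>. The factor 2 does not affect the order.\<close>

lemma le_max_modulus2:
  assumes f: "entire2 f" and "2 * norm z \<le> r"
  shows "norm (f z) \<le> max_modulus2 f r"
proof -
  obtain z1 z2 where [simp]: "z = (z1, z2)" by (cases z)
  have "norm z1 \<le> norm z" "norm z2 \<le> norm z"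
    using norm_fst_le[of z1 z2] norm_snd_le[of z2 z1] by simp_all
  hence "norm (z1 + \<i> * z2) \<le> r" "norm (z1 - \<i> * z2) \<le> r"
    using assms(2) norm_triangle_ineq[of z1 "\<i> * z2"] norm_triangle_ineq4[of z1 "\<i> * z2"]
    by (simp_all add: norm_mult)
  from bidisc_le_max_modulus2[OF f this] show ?thesis by simp
qed

section \<open>Passing between the order and pointwise growth bounds\<close>

lemma entire2_bounded_imp_constant:
  assumes f: "entire2 f" and bd: "\<And>z. norm (f z) \<le> B"
  shows "f constant_on UNIV"
proof -
  have "f z = f (0, 0)" for z
  proof -
    \<comment> \<open>Liouville's theorem on the complex line through the origin and
      \<open>z\<close>.\<close>
    have "(\<lambda>t. f (0 + fst z * t, 0 + snd z * t)) constant_on UNIV"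
      by (intro Liouville_theorem entire2_compose_affine[OF f])
         (use bd in \<open>auto simp: bounded_iff\<close>)
    then obtain k where "\<And>t. f (fst z * t, snd z * t) = k"
      by (auto simp: constant_on_def)
    from this[of 0] this[of 1] show ?thesis by simp
  qed
  thus ?thesis unfolding constant_on_def by blast
qed

text \<open>Applied with \<open>B = exp 1\<close>, this makes the inner logarithm at least 1, so
  that the iterated logarithm in the order is genuine and nonnegative for large
  \<open>r\<close>.\<close>

lemma eventually_max_modulus2_ge:
  assumes f: "entire2 f" and nc: "\<not> f constant_on UNIV"
  shows "eventually (\<lambda>r. max_modulus2 f r \<ge> B) at_top"
proof -
  obtain z where z: "norm (f z) > B"
    using entire2_bounded_imp_constant[OF f] nc by (meson not_le_imp_less)
  have "max_modulus2 f r \<ge> B" if "r \<ge> 2 * norm z" for r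
    using le_max_modulus2[OF f that] z by linarith
  thus ?thesis
    unfolding eventually_at_top_linorder by blast
qed

lemma growth_order2_nonneg:
  assumes f: "entire2 f"
  shows "growth_order2 f \<ge> 0"
proof (cases "f constant_on UNIV")
  case False
  have "eventually (\<lambda>r. 0 \<le> ereal (ln (ln (max_modulus2 f r)) / ln r)) at_top"
    using eventually_max_modulus2_ge[OF f False, of "exp 1"] eventually_gt_at_top[of 1]
  proof eventually_elim
    case (elim r)
    have "1 \<le> ln (max_modulus2 f r)"
      using elim(1) by (smt (verit) exp_gt_zero ln_exp ln_le_cancel_iff)
    with elim(2) show ?case by simp
  qed
  from le_Limsup[OF trivial_limit_at_top_linorder this] False show ?thesis
    by (simp add: growth_order2_def)
qed (simp add: growth_order2_def)

lemma growth_order2_less_imp_growth_le: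
  assumes f: "entire2 f" and less: "growth_order2 f < ereal \<tau>"
  shows "growth_le \<tau> f"
proof -
  have \<tau>: "\<tau> > 0"
    using order.strict_trans1[OF growth_order2_nonneg[OF f] less] by simp
  show ?thesis
  proof (cases "f constant_on UNIV")
    case True
    then obtain k where "f = (\<lambda>_. k)" unfolding constant_on_def by blast
    thus ?thesis using growth_le_const[of \<tau> k] \<tau> by simp
  next
    case False
    hence "Limsup at_top (\<lambda>r. ereal (ln (ln (max_modulus2 f r)) / ln r)) < ereal \<tau>"
      using less by (simp add: growth_order2_def)
    from Limsup_lessD[OF this]
    have "eventually (\<lambda>r. max_modulus2 f r \<le> exp (r powr \<tau>)) at_top"
      using eventually_max_modulus2_ge[OF f False, of "exp 1"] eventually_gt_at_top[of 1]
    proof eventually_elim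
      case (elim r)
      define M where "M = max_modulus2 f r"
      have M0: "M > 0" using elim(2) by (smt (verit) exp_gt_zero M_def)
      have "1 \<le> ln M"
        using elim(2) by (smt (verit) exp_gt_zero ln_exp ln_le_cancel_iff M_def)
      moreover have "ln (ln M) < \<tau> * ln r"
        using elim(1,3) by (simp add: M_def divide_less_eq)
      ultimately have "ln M \<le> exp (\<tau> * ln r)"
        by (smt (verit) exp_ln exp_less_cancel_iff)
      also have "\<dots> = r powr \<tau>" using elim(3) by (simp add: powr_def)
      finally show ?case
        using M0 by (metis M_def exp_le_cancel_iff exp_ln)
    qed
    then obtain R where R: "\<And>r. r \<ge> R \<Longrightarrow> max_modulus2 f r \<le> exp (r powr \<tau>)"
      unfolding eventually_at_top_linorder by blast
    \<comment> \<open>The upper limit controls only radii beyond \<open>R\<close>. The radius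
      \<open>A * (1 + norm z)\<close> exceeds both \<open>R\<close> and \<open>2 * norm z\<close>,
      which yields a bound at every \<open>z\<close>.\<close>
    define A where "A = \<bar>R\<bar> + 2"
    show ?thesis
    proof (rule growth_leI)
      fix z :: "complex \<times> complex"
      have A: "A * (1 + norm z) = \<bar>R\<bar> + 2 + \<bar>R\<bar> * norm z + 2 * norm z"
        by (simp add: A_def algebra_simps)
      have "\<bar>R\<bar> * norm z \<ge> 0" by simp
      hence "2 * norm z \<le> A * (1 + norm z)" "R \<le> A * (1 + norm z)"
        unfolding A using norm_ge_zero[of z] by linarith+
      hence "norm (f z) \<le> exp ((A * (1 + norm z)) powr \<tau>)"
        using le_max_modulus2[OF f] R by (meson order_trans)
      thus "norm (f z) \<le> exp (A powr \<tau> * (1 + norm z) powr \<tau>)"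
        by (simp add: powr_mult)
    qed
  qed
qed

lemma growth_le_imp_growth_order2_le:
  assumes h: "entire2 h" and g: "growth_le \<tau> h" and \<tau>: "\<tau> \<ge> 0"
  shows "growth_order2 h \<le> ereal \<tau>"
proof (cases "h constant_on UNIV")
  case True
  thus ?thesis using \<tau> by (simp add: growth_order2_def)
next
  case False
  from g obtain c where c: "c \<ge> 1" "\<And>z. norm (h z) \<le> exp (c * (1 + norm z) powr \<tau>)"
    by (metis growth_leE)
  \<comment> \<open>The numerator is the double logarithm of the assumed bound on the sphere of
    radius \<open>r\<close>; the constant \<open>c\<close> disappears in the limit.\<close>
  have lim: "((\<lambda>r. (ln c + \<tau> * ln (1 + r)) / ln r) \<longlongrightarrow> \<tau>) at_top"
    by real_asymp
  have "eventually (\<lambda>r. ereal (ln (ln (max_modulus2 h r)) / ln r)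
                        \<le> ereal ((ln c + \<tau> * ln (1 + r)) / ln r)) at_top"
    using eventually_max_modulus2_ge[OF h False, of "exp 1"] eventually_gt_at_top[of 1]
  proof eventually_elim
    case (elim r)
    define M where "M = max_modulus2 h r"
    have M0: "M > 0" using elim(1) by (smt (verit) exp_gt_zero M_def)
    have M1: "1 \<le> ln M"
      using elim(1) by (smt (verit) exp_gt_zero ln_exp ln_le_cancel_iff M_def)
    have "M \<le> exp (c * (1 + r) powr \<tau>)"
      unfolding M_def using elim(2) c(2) by (intro max_modulus2_le) auto
    hence "ln M \<le> c * (1 + r) powr \<tau>"
      using M0 by (metis exp_gt_zero ln_exp ln_le_cancel_iff)
    hence "ln (ln M) \<le> ln (c * (1 + r) powr \<tau>)"
      using M1 by (intro ln_mono) auto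
    also have "\<dots> = ln c + \<tau> * ln (1 + r)"
      using c(1) elim(2) by (simp add: ln_mult ln_powr)
    finally show ?case
      using elim(2) by (simp add: M_def divide_right_mono)
  qed
  hence "growth_order2 h \<le> Limsup at_top (\<lambda>r. ereal ((ln c + \<tau> * ln (1 + r)) / ln r))"
    using False by (simp add: growth_order2_def Limsup_mono)
  also have "\<dots> = ereal \<tau>"
    by (intro lim_imp_Limsup tendsto_ereal lim) simp
  finally show ?thesis .
qed

subsection \<open>Differential operators of infinite order\<close>

text \<open>Write the left side as \<open>(x + y) * (x + y) powr (\<sigma> - 1)\<close> and use that
  a power with nonpositive exponent is nonincreasing.\<close>

lemma powr_add_le:
  fixes x y \<sigma> :: real
  assumes "x > 0" "y > 0" "0 \<le> \<sigma>" "\<sigma> \<le> 1"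
  shows "(x + y) powr \<sigma> \<le> x powr \<sigma> + y powr \<sigma>"
proof -
  have "(x + y) powr \<sigma> = x * (x + y) powr (\<sigma> - 1) + y * (x + y) powr (\<sigma> - 1)"
    using assms powr_mult_base[of "x + y" "\<sigma> - 1"] by (simp add: distrib_right)
  also have "\<dots> \<le> x * x powr (\<sigma> - 1) + y * y powr (\<sigma> - 1)"
    using assms by (intro add_mono mult_left_mono powr_mono2') auto
  also have "\<dots> = x powr \<sigma> + y powr \<sigma>"
    using assms powr_mult_base[of x "\<sigma> - 1"] powr_mult_base[of y "\<sigma> - 1"] by simp
  finally show ?thesis .
qed

text \<open>A sublinear power falls below any line of positive slope eventually; \<open>A\<close>
  covers the remaining bounded range.\<close>

lemma powr_le_linear:
  fixes c \<sigma> \<epsilon> :: real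
  assumes "c \<ge> 0" "0 < \<sigma>" "\<sigma> < 1" "\<epsilon> > 0"
  obtains A where "A \<ge> 0" "\<And>x. x \<ge> 0 \<Longrightarrow> c * x powr \<sigma> \<le> A + \<epsilon> * x"
proof -
  have "eventually (\<lambda>x. c * x powr \<sigma> \<le> \<epsilon> * x) at_top"
    using assms by real_asymp
  then obtain X where X: "\<And>x. x \<ge> X \<Longrightarrow> c * x powr \<sigma> \<le> \<epsilon> * x"
    unfolding eventually_at_top_linorder by blast
  have "c * x powr \<sigma> \<le> c * \<bar>X\<bar> powr \<sigma> + \<epsilon> * x" if "x \<ge> 0" for x
  proof (cases "x \<ge> X")
    case True
    have "c * \<bar>X\<bar> powr \<sigma> \<ge> 0" using assms by simp
    with X[OF True] show ?thesis by linarith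
  next
    case False
    hence "c * x powr \<sigma> \<le> c * \<bar>X\<bar> powr \<sigma>"
      using that assms by (intro mult_left_mono powr_mono2) auto
    moreover have "\<epsilon> * x \<ge> 0" using assms that by simp
    ultimately show ?thesis by linarith
  qed
  thus ?thesis using assms by (intro that[of "c * \<bar>X\<bar> powr \<sigma>"]) auto
qed

text \<open>Cauchy's estimate on the circle of radius \<open>n e / \<delta>\<close>: since \<open>\<sigma> < 1\<close>, the factor
  \<open>n! / (n e / \<delta>)\<^sup>n\<close> dominates the growth of \<open>K\<close> on that circle.\<close>

lemma higher_deriv_growth:
  assumes hol: "K holomorphic_on UNIV" and c: "c \<ge> 0" and \<sigma>: "0 < \<sigma>" "\<sigma> < 1" and \<delta>: "\<delta> > 0"
    and K: "\<And>z. norm (K z) \<le> exp (c * (1 + norm z) powr \<sigma>)"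
  obtains Q where "Q > 0"
    "\<And>n z. norm ((deriv ^^ n) K z) \<le> Q * \<delta> ^ n * exp (c * (1 + norm z) powr \<sigma>)"
proof -
  define L where "L = exp 1 / \<delta>"
  have L: "L > 0" using \<delta> by (simp add: L_def)
  obtain A where A: "A \<ge> 0" "\<And>x. x \<ge> 0 \<Longrightarrow> c * x powr \<sigma> \<le> A + 1 / L * x"
    using powr_le_linear[OF c \<sigma>, of "1 / L"] L by auto
  have "norm ((deriv ^^ n) K z) \<le> exp A * \<delta> ^ n * exp (c * (1 + norm z) powr \<sigma>)" for n z
  proof (cases "n = 0")
    case True
    have "exp (c * (1 + norm z) powr \<sigma>) \<le> exp A * exp (c * (1 + norm z) powr \<sigma>)"
      using A(1) by (simp add: mult_le_cancel_right1)
    with K[of z] True show ?thesis by (simp add: order_trans)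
  next
    case False
    \<comment> \<open>With slope \<open>1 / L\<close> the growth on this circle costs
      \<open>exp (A + n)\<close>. Its factor \<open>exp n\<close> cancels against
      \<open>R ^ n\<close>, leaving \<open>fact n / n ^ n \<le> 1\<close> and
      \<open>\<delta> ^ n\<close>. The case \<open>n = 0\<close> is separate because the radius
      would vanish.\<close>
    define R where "R = real n * L"
    have R: "R > 0" using False L by (simp add: R_def)
    define E where "E = exp (c * (1 + norm z) powr \<sigma>)"
    have circle: "norm (K w) \<le> E * (exp A * exp 1 ^ n)" if "norm (z - w) = R" for w
    proof -
      have "norm w \<le> norm z + R"
        using that norm_triangle_ineq4[of z "z - w"] by simp
      hence "(1 + norm w) powr \<sigma> \<le> ((1 + norm z) + R) powr \<sigma>"
        using \<sigma> by (intro powr_mono2) auto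
      also have "\<dots> \<le> (1 + norm z) powr \<sigma> + R powr \<sigma>"
        using R \<sigma> by (intro powr_add_le) (auto simp: add_pos_nonneg)
      finally have "c * (1 + norm w) powr \<sigma> \<le> c * ((1 + norm z) powr \<sigma> + R powr \<sigma>)"
        using c by (intro mult_left_mono)
      also have "\<dots> \<le> c * (1 + norm z) powr \<sigma> + (A + real n)"
        using A(2)[of R] R L by (simp add: distrib_left R_def)
      finally have "exp (c * (1 + norm w) powr \<sigma>) \<le> exp (c * (1 + norm z) powr \<sigma> + (A + real n))"
        by simp
      also have "\<dots> = E * (exp A * exp 1 ^ n)"
        by (simp add: E_def exp_add flip: exp_of_nat_mult)
      finally show ?thesis using K[of w] by linarith
    qed
    have "norm ((deriv ^^ n) K z) \<le> fact n * (E * (exp A * exp 1 ^ n)) / R ^ n"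
      by (rule Cauchy_inequality[OF _ _ R circle])
         (use hol in \<open>auto intro: holomorphic_on_subset holomorphic_on_imp_continuous_on\<close>)
    also have "\<dots> = (fact n / real n ^ n) * (exp A * \<delta> ^ n * E)"
      using L \<delta> by (simp add: R_def L_def power_mult_distrib power_divide field_simps)
    also have "\<dots> \<le> 1 * (exp A * \<delta> ^ n * E)"
    proof (rule mult_right_mono)
      have "fact n \<le> real n ^ n"
        using fact_le_power[of n, where 'a = real] by simp
      thus "fact n / real n ^ n \<le> 1" using False by (simp add: divide_le_eq_1)
    qed (use \<delta> in \<open>simp add: E_def\<close>)
    finally show ?thesis by (simp add: E_def)
  qed
  thus ?thesis by (intro that[of "exp A"]) auto
qed

text \<open>By \<open>inv\<close>, \<open>b\<close> and \<open>d\<close> are coefficients of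
  reciprocal power series. For \<open>e n\<close> the \<open>n\<close>-th derivative of a function
  at a point, the claim says that the corresponding operators in \<partial> cancel there. The
  geometric bounds make the double series absolutely convergent, so it may be regrouped along
  \<open>k + j = n\<close>, where only \<open>n = 0\<close> survives.\<close>

lemma sums_convolution_inverse:
  fixes b d e :: "nat \<Rightarrow> complex" and \<delta> :: real
  assumes \<delta>: "\<delta> > 0"
    and b: "summable (\<lambda>k. norm (b k) * \<delta> ^ k)"
    and d: "summable (\<lambda>j. norm (d j) * \<delta> ^ j)"
    and e: "\<And>n. norm (e n) \<le> E * \<delta> ^ n"
    and inv: "\<And>n. (\<Sum>k\<le>n. b k * d (n - k)) = (if n = 0 then 1 else 0)"
  shows "(\<lambda>k. b k * (\<Sum>j. d j * e (k + j))) sums e 0"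
proof -
  define G where "G = (\<lambda>(k, j). b k * d j * e (k + j))"
  define H where "H = (\<lambda>(k, j). (norm (b k) * \<delta> ^ k) * E * (norm (d j) * \<delta> ^ j))"
  have GH: "norm (G (k, j)) \<le> H (k, j)" for k j
    using mult_left_mono[OF e[of "k + j"], of "norm (b k * d j)"]
    by (simp add: G_def H_def norm_mult power_add mult_ac)
  have E: "E \<ge> 0" using e[of 0] by (simp add: order_trans[OF norm_ge_zero])
  have sumH: "summable (\<lambda>j. H (k, j))" for k
    unfolding H_def by (auto intro!: summable_mult d)
  have "H summable_on UNIV \<times> UNIV"
  proof (rule summable_on_SigmaI)
    fix k
    show "((\<lambda>j. H (k, j)) has_sum (\<Sum>j. H (k, j))) UNIV"
      by (intro norm_summable_imp_has_sum summable_sums sumH)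
         (use sumH[of k] E \<delta> in \<open>simp add: H_def abs_mult\<close>)
  next
    have "(\<lambda>k. \<Sum>j. H (k, j)) = (\<lambda>k. norm (b k) * \<delta> ^ k * E * (\<Sum>j. norm (d j) * \<delta> ^ j))"
      by (simp add: H_def suminf_mult[OF d])
    moreover have "summable (\<lambda>k. norm (b k) * \<delta> ^ k * E * (\<Sum>j. norm (d j) * \<delta> ^ j))"
      by (intro summable_mult2 b)
    moreover have "norm (b k) * \<delta> ^ k * E * (\<Sum>j. norm (d j) * \<delta> ^ j) \<ge> 0" for k
      using E \<delta> by (intro mult_nonneg_nonneg suminf_nonneg d) auto
    ultimately show "(\<lambda>k. \<Sum>j. H (k, j)) summable_on UNIV"
      by (simp add: summable_on_UNIV_nonneg_real_iff)
  qed (use E \<delta> in \<open>auto simp: H_def\<close>)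
  hence "(\<lambda>x. norm (G x)) summable_on UNIV \<times> UNIV"
    by (rule summable_on_comparison_test) (use GH in auto)
  hence "G summable_on UNIV \<times> UNIV"
    by (rule abs_summable_summable)
  then obtain S where S: "(G has_sum S) (UNIV \<times> UNIV)"
    by (auto simp: summable_on_def)
  have "((\<lambda>k. b k * (\<Sum>j. d j * e (k + j))) has_sum S) UNIV"
  proof (rule has_sum_SigmaD[OF S])
    fix k
    have "summable (\<lambda>j. norm (d j * e (k + j)))"
    proof (rule summable_comparison_test')
      show "summable (\<lambda>j. E * \<delta> ^ k * (norm (d j) * \<delta> ^ j))"
        by (intro summable_mult d)
      show "norm (norm (d j * e (k + j))) \<le> E * \<delta> ^ k * (norm (d j) * \<delta> ^ j)" for j
        using mult_left_mono[OF e[of "k + j"], of "norm (d j)"]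
        by (simp add: norm_mult power_add mult_ac)
    qed
    hence "((\<lambda>j. d j * e (k + j)) has_sum (\<Sum>j. d j * e (k + j))) UNIV"
      by (intro norm_summable_imp_has_sum summable_sums) (auto intro: summable_norm_cancel)
    from has_sum_cmult_right[OF this, of "b k"]
    show "((\<lambda>j. G (k, j)) has_sum b k * (\<Sum>j. d j * e (k + j))) UNIV"
      by (simp add: G_def mult.assoc)
  qed
  moreover have "S = e 0"
  proof -
    \<comment> \<open>Summation by antidiagonals: the pair \<open>(k, j)\<close> is listed as
      \<open>(k + j, k)\<close>.\<close>
    have "((\<lambda>(n, k). G (k, n - k)) has_sum S) (Sigma UNIV (\<lambda>n. {..n}))"
      using S
      by (subst has_sum_reindex_bij_witness[where i = "\<lambda>(k, j). (k + j, k)"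
            and j = "\<lambda>(n, k). (k, n - k)" and T = "UNIV \<times> UNIV" and h = G and s' = S]) auto
    hence "((\<lambda>n. \<Sum>k\<le>n. G (k, n - k)) has_sum S) UNIV"
      by (rule has_sum_SigmaD) (auto intro: has_sum_finite)
    moreover have "(\<Sum>k\<le>n. G (k, n - k)) = (if n = 0 then e 0 else 0)" for n
    proof -
      have "(\<Sum>k\<le>n. G (k, n - k)) = (\<Sum>k\<le>n. b k * d (n - k)) * e n"
        by (simp add: G_def sum_distrib_right)
      thus ?thesis by (simp add: inv)
    qed
    ultimately have "((\<lambda>n::nat. if n = 0 then e 0 else 0) has_sum S) UNIV"
      by (simp cong: has_sum_cong)
    moreover have "((\<lambda>n::nat. if n = 0 then e 0 else 0) has_sum e 0) UNIV"
      by (rule has_sum_finite_neutralI[where B = "{0}"]) auto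
    ultimately show ?thesis by (rule has_sum_unique)
  qed
  ultimately show ?thesis by (simp add: has_sum_imp_sums)
qed

lemma entire_taylor:
  assumes "F holomorphic_on UNIV"
  shows "(\<lambda>n. (deriv ^^ n) F z / fact n * w ^ n) sums F (z + w)"
  using holomorphic_power_series[of F z "norm w + 1" "z + w"] assms holomorphic_on_subset
  by (auto simp: dist_norm)

text \<open>Formally the solution is \<open>(2 \<i> sin \<partial>)\<^sup>-\<^sup>1 K\<close>: an antiderivative of \<open>K\<close> absorbs the zero of
  \<open>sin\<close> at the origin, and the remaining operator is a power series in \<open>\<partial>\<close> of positive radius of
  convergence, which converges on functions of order less than \<open>1\<close>.\<close>

lemma difference_equation:
  assumes hol: "K holomorphic_on UNIV" and \<sigma>0: "0 < \<sigma>0" "\<sigma>0 < 1" "growth_le \<sigma>0 K"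
  obtains D where "D holomorphic_on UNIV" "\<And>u. D (u + \<i>) - D (u - \<i>) = K u"
    "\<And>\<sigma>. 0 < \<sigma> \<Longrightarrow> \<sigma> < 1 \<Longrightarrow> growth_le \<sigma> K \<Longrightarrow> growth_le \<sigma> D"
proof -
  obtain G where G: "\<And>z. (G has_field_derivative K z) (at z)"
    and G_growth: "\<And>\<sigma>. \<sigma> > 0 \<Longrightarrow> growth_le \<sigma> K \<Longrightarrow> growth_le \<sigma> G"
    using entire_antiderivative[OF hol] by blast
  have G_hol: "G holomorphic_on UNIV"
    using G by (auto simp: holomorphic_on_def field_differentiable_def)
  have deriv_G: "(deriv ^^ Suc n) G = (deriv ^^ n) K" for n
  proof -
    have "deriv G = K" using G by (auto simp: fun_eq_iff DERIV_imp_deriv)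
    thus ?thesis by (simp add: funpow_swap1)
  qed
  \<comment> \<open>These are the Taylor coefficients of
    \<open>(exp (\<i> t) - exp (- \<i> t)) / t\<close>, that is, of \<open>2 \<i> sin t / t\<close>.
    Dividing by \<open>t\<close> makes the constant term nonzero, so the series has a reciprocal,
    with coefficients \<open>b\<close> below.\<close>
  define d where "d = (\<lambda>j. (\<i> ^ Suc j - (- \<i>) ^ Suc j) / fact (Suc j))"
  have norm_d: "norm (d j) \<le> 2 / fact j" for j
  proof -
    have "norm (\<i> ^ Suc j - (- \<i>) ^ Suc j) \<le> 2"
      by (rule order_trans[OF norm_triangle_ineq4]) (simp add: norm_power norm_mult)
    moreover have "(fact j :: real) \<le> fact (Suc j)"
      by (intro fact_mono) auto
    ultimately show ?thesis
      unfolding d_def norm_divide norm_fact by (intro frac_le) auto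
  qed
  have sum_d: "summable (\<lambda>j. norm (d j) * r ^ j)" if "r > 0" for r
  proof (rule summable_comparison_test')
    show "summable (\<lambda>j. 2 * (inverse (fact j) * r ^ j))"
      by (intro summable_mult summable_exp)
    show "norm (norm (d j) * r ^ j) \<le> 2 * (inverse (fact j) * r ^ j)" for j
      using mult_right_mono[OF norm_d[of j], of "r ^ j"] that
      by (simp add: field_simps abs_mult)
  qed
  define fd where "fd = Abs_fps d"
  define b where "b = fps_nth (inverse fd)"
  have fd0: "fps_nth fd 0 \<noteq> 0"
    by (simp add: fd_def d_def)
  have "fps_conv_radius fd \<ge> norm (1 :: complex)"
    unfolding fps_conv_radius_def
    by (rule conv_radius_geI) (use sum_d[of 1] in \<open>auto simp: fd_def intro: summable_norm_cancel\<close>)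
  hence "fps_conv_radius fd > 0"
    by (rule less_le_trans[rotated]) simp
  hence "fps_conv_radius (inverse fd) > 0"
    using fps_conv_radius_inverse_pos fd0 by blast
  \<comment> \<open>Any radius strictly inside the disc of convergence of the reciprocal works,
    because the derivatives of \<open>G\<close> are bounded by multiples of
    \<open>\<delta> ^ k\<close> however small \<delta> is.\<close>
  then obtain \<delta> :: real where \<delta>: "0 < \<delta>" "ereal \<delta> < fps_conv_radius (inverse fd)"
    using ereal_dense2 by (metis ereal_less(2))
  have sum_b: "summable (\<lambda>k. norm (b k) * \<delta> ^ k)"
    using norm_summable_fps[of "complex_of_real \<delta>" "inverse fd"] \<delta>
    by (simp add: b_def norm_mult norm_power)
  have inv: "(\<Sum>k\<le>n. b k * d (n - k)) = (if n = 0 then 1 else 0)" for n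
  proof -
    have "inverse fd * fd = 1" by (rule inverse_mult_eq_1[OF fd0])
    hence "fps_nth (inverse fd * fd) n = (if n = 0 then 1 else 0)" by simp
    thus ?thesis by (simp add: fps_mult_nth b_def fd_def atLeast0AtMost)
  qed
  \<comment> \<open>Kept general in \<open>\<sigma>\<close>: the exponent \<open>\<sigma>0\<close>
    gives convergence of the series defining \<open>D\<close>, and other exponents then give finer
    growth bounds for the same \<open>D\<close>.\<close>
  have bound: "\<exists>Q>0. \<forall>k u. norm (b k * (deriv ^^ k) G u) \<le>
      norm (b k) * \<delta> ^ k * (Q * exp (c * (1 + norm u) powr \<sigma>))"
    if \<sigma>: "0 < \<sigma>" "\<sigma> < 1" and c: "c \<ge> 0" "\<And>z. norm (G z) \<le> exp (c * (1 + norm z) powr \<sigma>)"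
    for c \<sigma>
  proof -
    obtain Q where Q: "Q > 0"
      "\<And>n z. norm ((deriv ^^ n) G z) \<le> Q * \<delta> ^ n * exp (c * (1 + norm z) powr \<sigma>)"
      using higher_deriv_growth[OF G_hol c(1) \<sigma> \<delta>(1) c(2)] by blast
    have "norm (b k * (deriv ^^ k) G u) \<le> norm (b k) * \<delta> ^ k * (Q * exp (c * (1 + norm u) powr \<sigma>))"
      for k u
      using mult_left_mono[OF Q(2)[of k u], of "norm (b k)"] by (simp add: norm_mult mult_ac)
    with Q(1) show ?thesis by blast
  qed
  define D where "D = (\<lambda>u. \<Sum>k. b k * (deriv ^^ k) G u)"
  obtain c0 where c0: "c0 \<ge> 1" "\<And>z. norm (G z) \<le> exp (c0 * (1 + norm z) powr \<sigma>0)"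
    using G_growth[OF \<sigma>0(1,3)] by (metis growth_leE)
  obtain Q0 where Q0: "Q0 > 0" "\<And>k u. norm (b k * (deriv ^^ k) G u) \<le>
      norm (b k) * \<delta> ^ k * (Q0 * exp (c0 * (1 + norm u) powr \<sigma>0))"
    using bound[OF \<sigma>0(1,2) _ c0(2)] c0(1) by auto
  have summ: "summable (\<lambda>k. norm (b k * (deriv ^^ k) G u))" for u
    by (rule summable_comparison_test'[OF summable_mult2[OF sum_b]]) (use Q0(2) in auto)
  have D_sums: "(\<lambda>k. b k * (deriv ^^ k) G u) sums D u" for u
    unfolding D_def by (intro summable_sums summable_norm_cancel[OF summ])
  have "D holomorphic_on UNIV"
  proof (rule holomorphic_uniform_sequence)
    show "(\<lambda>u. \<Sum>k<n. b k * (deriv ^^ k) G u) holomorphic_on UNIV" for n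
      by (intro holomorphic_intros holomorphic_higher_deriv[OF G_hol]) auto
    fix x :: complex
    have "uniform_limit (cball x 1) (\<lambda>n u. \<Sum>k<n. b k * (deriv ^^ k) G u) D sequentially"
      unfolding D_def
    proof (rule Weierstrass_m_test)
      fix k u assume "u \<in> cball x 1"
      hence "norm u \<le> norm x + 1"
        using norm_triangle_ineq4[of x "x - u"] by (simp add: dist_norm)
      hence "(1 + norm u) powr \<sigma>0 \<le> (2 + norm x) powr \<sigma>0"
        using \<sigma>0 by (intro powr_mono2) auto
      hence "Q0 * exp (c0 * (1 + norm u) powr \<sigma>0) \<le> Q0 * exp (c0 * (2 + norm x) powr \<sigma>0)"
        using Q0 c0 by simp
      hence "norm (b k) * \<delta> ^ k * (Q0 * exp (c0 * (1 + norm u) powr \<sigma>0)) \<le>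
             norm (b k) * \<delta> ^ k * (Q0 * exp (c0 * (2 + norm x) powr \<sigma>0))"
        by (rule mult_left_mono) (use \<delta> in simp)
      with Q0(2)[of k u] show "norm (b k * (deriv ^^ k) G u) \<le>
          norm (b k) * \<delta> ^ k * (Q0 * exp (c0 * (2 + norm x) powr \<sigma>0))"
        by linarith
    qed (intro summable_mult2 sum_b)
    thus "\<exists>d>0. cball x d \<subseteq> UNIV \<and>
        uniform_limit (cball x d) (\<lambda>n u. \<Sum>k<n. b k * (deriv ^^ k) G u) D sequentially"
      by (intro exI[of _ 1]) auto
  qed auto

  moreover have "D (u + \<i>) - D (u - \<i>) = K u" for u
  proof -
    define e where "e = (\<lambda>n. (deriv ^^ n) K u)"
    have taylor: "(\<Sum>j. d j * e (k + j)) = (deriv ^^ k) G (u + \<i>) - (deriv ^^ k) G (u - \<i>)" for k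
    proof -
      let ?H = "(deriv ^^ k) G"
      let ?f = "\<lambda>n. (deriv ^^ n) ?H u / fact n * \<i> ^ n - (deriv ^^ n) ?H u / fact n * (- \<i>) ^ n"
      have "?H holomorphic_on UNIV" by (intro holomorphic_higher_deriv G_hol) auto
      from sums_diff[OF entire_taylor[OF this] entire_taylor[OF this]]
      have "?f sums (?H (u + \<i>) - ?H (u + - \<i>))" .
      \<comment> \<open>The terms of index 0 in the two Taylor series cancel; from index 1 on,
        derivatives of \<open>G\<close> are derivatives of \<open>K\<close>.\<close>
      hence "(\<lambda>n. ?f (Suc n)) sums (?H (u + \<i>) - ?H (u - \<i>))"
        by (subst sums_Suc_iff) simp
      moreover have "?f (Suc n) = d n * e (k + n)" for n
      proof -
        have "(deriv ^^ Suc n) ?H = (deriv ^^ Suc (k + n)) G"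
          by (metis add.commute add_Suc comp_apply funpow_add)
        thus ?thesis
          unfolding deriv_G d_def e_def
          by (simp add: field_simps) (simp add: add_divide_distrib)
      qed
      ultimately show ?thesis by (simp add: sums_iff)
    qed
    obtain c where "c \<ge> 1" and c: "\<And>z. norm (K z) \<le> exp (c * (1 + norm z) powr \<sigma>0)"
      using \<sigma>0(3) by (metis growth_leE)
    obtain Q where Q: "\<And>n z. norm ((deriv ^^ n) K z) \<le> Q * \<delta> ^ n * exp (c * (1 + norm z) powr \<sigma>0)"
      using higher_deriv_growth[OF hol order_trans[OF zero_le_one \<open>c \<ge> 1\<close>] \<sigma>0(1,2) \<delta>(1) c] by blast
    have "norm (e n) \<le> Q * exp (c * (1 + norm u) powr \<sigma>0) * \<delta> ^ n" for n
      using Q[of n u] by (simp add: e_def mult_ac)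
    from sums_convolution_inverse[OF \<delta>(1) sum_b sum_d[OF \<delta>(1)] this inv]
    have "(\<lambda>k. b k * (deriv ^^ k) G (u + \<i>) - b k * (deriv ^^ k) G (u - \<i>)) sums K u"
      unfolding taylor by (simp add: e_def right_diff_distrib)
    moreover have "(\<lambda>k. b k * (deriv ^^ k) G (u + \<i>) - b k * (deriv ^^ k) G (u - \<i>))
        sums (D (u + \<i>) - D (u - \<i>))"
      by (intro sums_diff D_sums)
    ultimately show ?thesis by (rule sums_unique2[symmetric])
  qed

  moreover have "growth_le \<sigma> D" if \<sigma>: "0 < \<sigma>" "\<sigma> < 1" and K: "growth_le \<sigma> K" for \<sigma>
  proof -
    obtain c where c: "c \<ge> 1" "\<And>z. norm (G z) \<le> exp (c * (1 + norm z) powr \<sigma>)"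
      using G_growth[OF \<sigma>(1) K] by (metis growth_leE)
    obtain Q where Q: "Q > 0" "\<And>k u. norm (b k * (deriv ^^ k) G u) \<le>
        norm (b k) * \<delta> ^ k * (Q * exp (c * (1 + norm u) powr \<sigma>))"
      using bound[OF \<sigma> _ c(2)] c(1) by auto
    define B where "B = (\<Sum>k. norm (b k) * \<delta> ^ k)"
    have B: "B \<ge> 0" unfolding B_def using \<delta> by (intro suminf_nonneg sum_b) auto
    have "growth_le \<sigma> (\<lambda>u::complex. of_real (B * Q) * of_real (exp (c * (1 + norm u) powr \<sigma>)))"
      by (intro growth_le_mult growth_le_const growth_leI[of _ c]) (use \<sigma> in auto)
    thus ?thesis
    proof (rule growth_le_mono)
      fix u
      have "norm (D u) \<le> (\<Sum>k. norm (b k * (deriv ^^ k) G u))"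
        unfolding D_def by (rule summable_norm[OF summ])
      also have "\<dots> \<le> (\<Sum>k. norm (b k) * \<delta> ^ k * (Q * exp (c * (1 + norm u) powr \<sigma>)))"
        by (intro suminf_le Q summ summable_mult2 sum_b)
      also have "\<dots> = B * (Q * exp (c * (1 + norm u) powr \<sigma>))"
        unfolding B_def by (rule suminf_mult2[symmetric, OF sum_b])
      also have "\<dots> = norm (complex_of_real (B * Q) * of_real (exp (c * (1 + norm u) powr \<sigma>)))"
        using B Q by (simp add: norm_mult mult.assoc)
      finally show "norm (D u) \<le>
          norm (complex_of_real (B * Q) * of_real (exp (c * (1 + norm u) powr \<sigma>)))" .
    qed
  qed
  ultimately show ?thesis using that by blast
qed

subsection \<open>Interpolation on the parabola\<close>

text \<open>The second derivatives in the two variables carry the factors 1 and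
  \<open>(\<plusminus>\<i>)\<^sup>2 = -1\<close>, so they cancel for each summand.\<close>

lemma entire_harmonic2_sum:
  assumes \<phi>: "\<phi> holomorphic_on UNIV" and \<psi>: "\<psi> holomorphic_on UNIV"
  shows "entire_harmonic2 (\<lambda>z. \<phi> (fst z + \<i> * snd z) + \<psi> (fst z - \<i> * snd z))"
proof -
  have deriv_affine: "((\<lambda>t. F (A + B * t)) has_field_derivative B * deriv F (A + B * t)) (at t)"
    if "F holomorphic_on UNIV" for F A B and t :: complex
  proof -
    have F: "(F has_field_derivative deriv F (A + B * t)) (at (A + B * t))"
      using that holomorphic_derivI by blast
    have "((\<lambda>t. A + B * t) has_field_derivative B) (at t)"
      by (auto intro!: derivative_eq_intros)
    from DERIV_chain2[OF F this] show ?thesis by (simp add: mult.commute)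
  qed
  have hol': "deriv \<phi> holomorphic_on UNIV" "deriv \<psi> holomorphic_on UNIV"
    using \<phi> \<psi> by (auto intro: holomorphic_deriv)
  have second: "(deriv ^^ 2) (\<lambda>t. \<phi> (A + B * t) + \<psi> (A' + B' * t)) t
      = B\<^sup>2 * deriv (deriv \<phi>) (A + B * t) + B'\<^sup>2 * deriv (deriv \<psi>) (A' + B' * t)" for A B A' B' t
  proof -
    have "deriv (\<lambda>t. \<phi> (A + B * t) + \<psi> (A' + B' * t))
        = (\<lambda>t. B * deriv \<phi> (A + B * t) + B' * deriv \<psi> (A' + B' * t))"
      by (rule ext, rule DERIV_imp_deriv) (intro DERIV_add deriv_affine \<phi> \<psi>)
    moreover have "deriv (\<lambda>t. B * deriv \<phi> (A + B * t) + B' * deriv \<psi> (A' + B' * t)) t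
        = B * (B * deriv (deriv \<phi>) (A + B * t)) + B' * (B' * deriv (deriv \<psi>) (A' + B' * t))"
      by (rule DERIV_imp_deriv) (intro DERIV_add DERIV_cmult deriv_affine hol')
    ultimately show ?thesis by (simp add: numeral_2_eq_2)
  qed
  have "laplacian2 (\<lambda>z. \<phi> (fst z + \<i> * snd z) + \<psi> (fst z - \<i> * snd z)) z = 0" for z
    using second[of "\<i> * snd z" 1 "- \<i> * snd z" 1 "fst z"]
      second[of "fst z" \<i> "fst z" "- \<i>" "snd z"]
    unfolding laplacian2_def by (simp add: add.commute)
  moreover have "entire2 (\<lambda>z. \<phi> (fst z + \<i> * snd z) + \<psi> (fst z - \<i> * snd z))"
    unfolding entire2_def
  proof
    fix z :: "complex \<times> complex"
    define p where "p = deriv \<phi> (fst z + \<i> * snd z)"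
    define q where "q = deriv \<psi> (fst z - \<i> * snd z)"
    have \<phi>': "(\<phi> has_derivative (*) p) (at (fst z + \<i> * snd z))"
      using \<phi> holomorphic_derivI by (force simp: p_def simp flip: has_field_derivative_def)
    have \<psi>': "(\<psi> has_derivative (*) q) (at (fst z - \<i> * snd z))"
      using \<psi> holomorphic_derivI by (force simp: q_def simp flip: has_field_derivative_def)
    have lin: "((\<lambda>z. fst z + \<i> * snd z) has_derivative (\<lambda>v. fst v + \<i> * snd v)) (at z)"
      "((\<lambda>z. fst z - \<i> * snd z) has_derivative (\<lambda>v. fst v - \<i> * snd v)) (at z)"
      by (auto intro!: derivative_eq_intros)
    have "((\<lambda>z. \<phi> (fst z + \<i> * snd z) + \<psi> (fst z - \<i> * snd z)) has_derivative
        (\<lambda>v. p * (fst v + \<i> * snd v) + q * (fst v - \<i> * snd v))) (at z)"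
      by (intro has_derivative_add has_derivative_compose[OF lin(1) \<phi>']
          has_derivative_compose[OF lin(2) \<psi>'])
    also have "(\<lambda>v. p * (fst v + \<i> * snd v) + q * (fst v - \<i> * snd v)) =
        (\<lambda>v. (p + q) * fst v + (p * \<i> - q * \<i>) * snd v)"
      by (simp add: fun_eq_iff algebra_simps)
    finally show "\<exists>a b. ((\<lambda>z. \<phi> (fst z + \<i> * snd z) + \<psi> (fst z - \<i> * snd z)) has_derivative
        (\<lambda>v. a * fst v + b * snd v)) (at z)" by blast
  qed
  ultimately show ?thesis by (simp add: entire_harmonic2_def)
qed

theorem theorem4:
  fixes f :: "complex \<times> complex \<Rightarrow> complex" and a :: real
  assumes "entire2 f"
    and "growth_order2 f < 1 / 2"
    and "a \<noteq> 0"
  shows "\<exists>h. entire_harmonic2 h \<and> growth_order2 h \<le> growth_order2 f \<and>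
           (\<forall>(x1, x2) \<in> parabola a.
              h (complex_of_real x1, complex_of_real x2) = f (complex_of_real x1, complex_of_real x2))"
proof -
  define A where "A = complex_of_real a"
  have A0: "A \<noteq> 0" using assms(3) by (simp add: A_def)
  \<comment> \<open>The parameter is \<open>s = x2 / a\<close>. The quadratic substitution doubles
    exponents, so order below 1/2 becomes an exponent below 1, as the difference equation
    requires.\<close>
  define F where "F = (\<lambda>s. f (A * s\<^sup>2, A * s))"
  have F_hol: "F holomorphic_on UNIV"
    unfolding F_def
    by (rule entire2_compose[OF assms(1), where p' = "\<lambda>s. 2 * A * s" and q' = "\<lambda>_. A"])
       (auto intro!: derivative_eq_intros)
  have F_growth: "growth_le (2 * \<tau>) F" if "growth_le \<tau> f" "\<tau> \<ge> 0" for \<tau>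
  proof -
    have "1 + norm (A * s\<^sup>2, A * s) \<le> (1 + 2 * norm A) * (1 + norm s) powr 2" for s
    proof -
      have "norm (A * s\<^sup>2, A * s) \<le> norm A * (norm s)\<^sup>2 + norm A * norm s"
        by (rule order_trans[OF norm_Pair_le]) (simp add: norm_mult norm_power)
      also have "1 + \<dots> \<le> (1 + 2 * norm A) * (1 + norm s)\<^sup>2"
        by (simp add: power2_eq_square algebra_simps)
      finally show ?thesis by (simp add: add_pos_nonneg powr_numeral)
    qed
    from growth_le_compose[OF that _ this] show ?thesis by (simp add: F_def)
  qed
  have shift: "1 + norm (s + w) \<le> (1 + norm w) * (1 + norm s)" for s w :: complex
    using norm_triangle_ineq[of s w] by (simp add: algebra_simps) (smt (verit) mult_nonneg_nonneg norm_ge_zero)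
  have growth_shift: "growth_le \<sigma> (\<lambda>s. H (s + w))" if "growth_le \<sigma> H" "\<sigma> \<ge> 0"
    for \<sigma> w and H :: "complex \<Rightarrow> complex"
    by (rule growth_le_compose_linear[OF that _ shift]) simp
  have growth_reflect: "growth_le \<sigma> (\<lambda>s. H (- s))" if "growth_le \<sigma> H" "\<sigma> \<ge> 0"
    for \<sigma> and H :: "complex \<Rightarrow> complex"
    by (rule growth_le_compose_linear[OF that, of 1]) simp_all
  have hol_affine: "(\<lambda>s. H (B * s + w)) holomorphic_on UNIV" if "H holomorphic_on UNIV"
    for H B w
    using holomorphic_on_compose_gen[OF _ that, of "\<lambda>s. B * s + w" UNIV, unfolded o_def]
    by (simp add: holomorphic_intros)

  text \<open>On the parabola, parametrised by \<open>(a s\<^sup>2, a s)\<close>, one has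
    \<open>x\<^sub>1 \<plusminus> \<i> x\<^sub>2 = a ((s \<plusminus> \<i>/2)\<^sup>2 + 1/4)\<close>.  With \<open>\<Phi> u = \<phi> (a (u\<^sup>2 + 1/4))\<close> and likewise \<open>\<Psi>\<close>, the
    condition on \<open>h = \<phi> (x\<^sub>1 + \<i> x\<^sub>2) + \<psi> (x\<^sub>1 - \<i> x\<^sub>2)\<close> is \<open>\<Phi> (s + \<i>/2) + \<Psi> (s - \<i>/2) = F s\<close> with
    even \<open>\<Phi>\<close>, \<open>\<Psi>\<close>; evenness of \<open>\<Phi>\<close> is a difference equation for \<open>\<Psi>\<close>.\<close>

  define K where "K = (\<lambda>u. F (- (u + \<i> / 2)) - F (u + (- \<i> / 2)))"
  have K_hol: "K holomorphic_on UNIV"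
    unfolding K_def
    using hol_affine[OF F_hol, of "-1" "- \<i> / 2"] hol_affine[OF F_hol, of 1 "- \<i> / 2"]
    by (intro holomorphic_on_diff) auto
  have K_growth: "growth_le \<sigma> K" if "growth_le \<sigma> F" "\<sigma> \<ge> 0" for \<sigma>
    unfolding K_def
    by (intro growth_le_diff growth_shift[where H = "\<lambda>s. F (- s)"] growth_shift growth_reflect that)
  \<comment> \<open>This exponent serves to construct \<open>D\<close> once; the sharper bounds come
    from letting the exponent approach the order of \<open>f\<close> afterwards.\<close>
  obtain \<tau>0 where \<tau>0: "growth_order2 f < ereal \<tau>0" "\<tau>0 < 1 / 2"
  proof -
    from assms(2) have "growth_order2 f < ereal (1 / 2)" by (simp add: one_ereal_def)
    from ereal_dense2[OF this] show ?thesis using that by auto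
  qed
  have pos: "\<tau> > 0" if "growth_order2 f < ereal \<tau>" for \<tau>
    using order.strict_trans1[OF growth_order2_nonneg[OF assms(1)] that] by simp
  have KF: "growth_le (2 * \<tau>) F" "growth_le (2 * \<tau>) K" if "growth_order2 f < ereal \<tau>" for \<tau>
    using K_growth[OF F_growth] F_growth growth_order2_less_imp_growth_le[OF assms(1) that]
      pos[OF that] by auto
  obtain D where D_hol: "D holomorphic_on UNIV"
    and D: "\<And>u. D (u + \<i>) - D (u - \<i>) = K u"
    and D_growth: "\<And>\<sigma>. 0 < \<sigma> \<Longrightarrow> \<sigma> < 1 \<Longrightarrow> growth_le \<sigma> K \<Longrightarrow> growth_le \<sigma> D"
    using difference_equation[OF K_hol _ _ KF(2)[OF \<tau>0(1)]] pos[OF \<tau>0(1)] \<tau>0(2) by auto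

  \<comment> \<open>Since \<open>K\<close> is odd, \<open>D (- u)\<close> solves the same equation
    as \<open>D u\<close>; their average is an even solution.\<close>
  define \<Psi> where "\<Psi> = (\<lambda>u. (1 / 2) * (D u + D (- u)))"
  have \<Psi>_hol: "\<Psi> holomorphic_on UNIV"
    unfolding \<Psi>_def using hol_affine[OF D_hol, of "-1" 0]
    by (intro holomorphic_intros D_hol) auto
  have \<Psi>_even: "\<Psi> (- u) = \<Psi> u" for u
    by (simp add: \<Psi>_def add.commute)
  have \<Psi>_diff: "\<Psi> (u + \<i>) - \<Psi> (u - \<i>) = K u" for u
  proof -
    have "K (- u) = - K u" by (simp add: K_def)
    hence 1: "D (- u - \<i>) = K u + D (- u + \<i>)" and 2: "D (u + \<i>) = K u + D (u - \<i>)"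
      using D[of u] D[of "- u"] by (simp_all add: algebra_simps)
    have "- (u + \<i>) = - u - \<i>" "- (u - \<i>) = - u + \<i>" by simp_all
    thus ?thesis unfolding \<Psi>_def by (simp only: 1 2) (simp add: field_simps)
  qed
  \<comment> \<open>The interpolation condition at \<open>s = u - \<i> / 2\<close>, solved for
    \<Phi>. As \<Psi> is even, \<open>\<Psi> (- u - \<i>) = \<Psi> (u + \<i>)\<close>, so evenness
    of \<Phi> is exactly the equation \<open>\<Psi>_diff\<close>.\<close>
  define \<Phi> where "\<Phi> = (\<lambda>u. F (u + (- \<i> / 2)) - \<Psi> (u + (- \<i>)))"
  have \<Phi>_hol: "\<Phi> holomorphic_on UNIV"
    unfolding \<Phi>_def
    using hol_affine[OF F_hol, of 1 "- \<i> / 2"] hol_affine[OF \<Psi>_hol, of 1 "- \<i>"]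
    by (intro holomorphic_on_diff) auto
  have \<Phi>_even: "\<Phi> (- u) = \<Phi> u" for u
  proof -
    have "\<Psi> (- u - \<i>) = \<Psi> (u + \<i>)"
      using \<Psi>_even[of "u + \<i>"] by simp
    thus ?thesis
      using \<Psi>_diff[of u] by (simp add: \<Phi>_def K_def algebra_simps)
  qed
  have growth: "growth_le (2 * \<tau>) \<Phi>" "growth_le (2 * \<tau>) \<Psi>"
    if "growth_order2 f < ereal \<tau>" "\<tau> < 1 / 2" for \<tau>
  proof -
    have \<tau>: "\<tau> > 0" using pos that by blast
    have D': "growth_le (2 * \<tau>) D"
      using D_growth[of "2 * \<tau>"] KF(2)[OF that(1)] \<tau> that(2) by auto
    show \<Psi>: "growth_le (2 * \<tau>) \<Psi>"
      unfolding \<Psi>_def using \<tau>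
      by (intro growth_le_mult growth_le_const growth_le_add growth_reflect D') auto
    show "growth_le (2 * \<tau>) \<Phi>"
      unfolding \<Phi>_def using \<tau>
      by (intro growth_le_diff growth_shift \<Psi> KF(1) that) auto
  qed

  \<comment> \<open>Descent from even functions to the harmonic function\<close>
  obtain p where p: "p holomorphic_on UNIV" "\<And>z. \<Phi> z = p (z\<^sup>2)"
    "\<And>\<sigma>. \<sigma> \<ge> 0 \<Longrightarrow> growth_le \<sigma> \<Phi> \<Longrightarrow> growth_le (\<sigma> / 2) p"
    using even_entire[OF \<Phi>_hol \<Phi>_even] by blast
  obtain q where q: "q holomorphic_on UNIV" "\<And>z. \<Psi> z = q (z\<^sup>2)"
    "\<And>\<sigma>. \<sigma> \<ge> 0 \<Longrightarrow> growth_le \<sigma> \<Psi> \<Longrightarrow> growth_le (\<sigma> / 2) q"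
    using even_entire[OF \<Psi>_hol \<Psi>_even] by blast
  \<comment> \<open>The argument inverts the affine map taking \<open>u\<^sup>2\<close> to
    \<open>a (u\<^sup>2 + 1/4)\<close>.\<close>
  define \<phi> where "\<phi> = (\<lambda>z. p (1 / A * z + (- 1 / 4)))"
  define \<psi> where "\<psi> = (\<lambda>z. q (1 / A * z + (- 1 / 4)))"
  define h where "h = (\<lambda>z. \<phi> (fst z + \<i> * snd z) + \<psi> (fst z - \<i> * snd z))"
  have harm: "entire_harmonic2 h"
    unfolding h_def \<phi>_def \<psi>_def by (intro entire_harmonic2_sum hol_affine p q)

  \<comment> \<open>The order of \<open>h\<close>\<close>
  have h_growth: "growth_order2 h \<le> ereal \<tau>" if \<tau>: "growth_order2 f < ereal \<tau>" "\<tau> < 1 / 2" for \<tau>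
  proof -
    have \<tau>0: "\<tau> \<ge> 0" using pos[OF that(1)] by simp
    have gp: "growth_le \<tau> p" "growth_le \<tau> q"
      using p(3)[OF _ growth(1)[OF \<tau>]] q(3)[OF _ growth(2)[OF \<tau>]] \<tau>0 by auto
    define B where "B = 2 * (1 + norm (1 / A))"
    have lin: "1 + norm (1 / A * (fst z + \<epsilon> * snd z) + (- 1 / 4)) \<le> B * (1 + norm z)"
      if \<epsilon>: "norm \<epsilon> = 1" for z :: "complex \<times> complex" and \<epsilon>
    proof -
      have "norm (fst z) \<le> norm z" "norm (snd z) \<le> norm z"
        using norm_fst_le[of "fst z" "snd z"] norm_snd_le[of "snd z" "fst z"] by simp_all
      hence "norm (fst z + \<epsilon> * snd z) \<le> 2 * norm z"
        using norm_triangle_ineq[of "fst z" "\<epsilon> * snd z"] \<epsilon> by (simp add: norm_mult)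
      hence "norm (1 / A) * norm (fst z + \<epsilon> * snd z) \<le> norm (1 / A) * (2 * norm z)"
        by (intro mult_left_mono) auto
      hence "1 + norm (1 / A * (fst z + \<epsilon> * snd z) + (- 1 / 4)) \<le> 5 / 4 + norm (1 / A) * (2 * norm z)"
        using norm_triangle_ineq[of "1 / A * (fst z + \<epsilon> * snd z)" "- 1 / 4"]
        by (simp only: norm_mult) simp
      also have "\<dots> \<le> B * (1 + norm z)"
        by (simp add: B_def algebra_simps)
      finally show ?thesis .
    qed
    have B: "B \<ge> 0" by (simp add: B_def)
    have "growth_le \<tau> h"
      unfolding h_def \<phi>_def \<psi>_def
    proof (rule growth_le_add)
      show "growth_le \<tau> (\<lambda>z. p (1 / A * (fst z + \<i> * snd z) + - 1 / 4))"
        by (rule growth_le_compose_linear[OF gp(1) \<tau>0 B]) (rule lin, simp)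
      show "growth_le \<tau> (\<lambda>z. q (1 / A * (fst z - \<i> * snd z) + - 1 / 4))"
        by (rule growth_le_compose_linear[OF gp(2) \<tau>0 B]) (use lin[of "- \<i>"] in simp)
    qed (rule \<tau>0)
    thus ?thesis
      using growth_le_imp_growth_order2_le harm \<tau>0 unfolding entire_harmonic2_def by blast
  qed
  have "growth_order2 h \<le> growth_order2 f"
  proof (rule dense_le)
    fix x :: ereal assume "x < growth_order2 h"
    show "x \<le> growth_order2 f"
    proof (rule ccontr)
      assume "\<not> x \<le> growth_order2 f"
      \<comment> \<open>Bounds are available only for exponents strictly above the order of
        \<open>f\<close> and below 1/2. One below both \<open>x\<close> and \<open>\<tau>0\<close>
        bounds the order of \<open>h\<close> by less than \<open>x\<close>, a contradiction.\<close>
      hence "growth_order2 f < min x (ereal \<tau>0)" using \<tau>0(1) by simp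
      then obtain \<tau> where "growth_order2 f < ereal \<tau>" "ereal \<tau> < min x (ereal \<tau>0)"
        using ereal_dense2 by blast
      hence "growth_order2 h \<le> ereal \<tau>" "ereal \<tau> < x"
        using h_growth[of \<tau>] \<tau>0(2) by auto
      with \<open>x < growth_order2 h\<close> show False by auto
    qed
  qed

  \<comment> \<open>Agreement with \<open>f\<close> on the parabola\<close>
  moreover have "h (complex_of_real x1, complex_of_real x2) = f (complex_of_real x1, complex_of_real x2)"
    if "(x1, x2) \<in> parabola a" for x1 x2
  proof -
    define s where "s = complex_of_real x2 / A"
    have x2: "complex_of_real x2 = A * s" using A0 by (simp add: s_def)
    have "A * complex_of_real x1 = (complex_of_real x2)\<^sup>2"
      using that unfolding parabola_def A_def by (simp flip: of_real_mult of_real_power)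
    hence x1: "complex_of_real x1 = A * s\<^sup>2"
      using A0 unfolding x2 by (simp add: power2_eq_square)
    have "1 / A * (A * s\<^sup>2 + \<i> * (A * s)) + (- 1 / 4) = (s + \<i> / 2)\<^sup>2"
      using A0 by (simp add: power2_eq_square field_simps)
    moreover have "1 / A * (A * s\<^sup>2 - \<i> * (A * s)) + (- 1 / 4) = (s - \<i> / 2)\<^sup>2"
      using A0 by (simp add: power2_eq_square field_simps)
    ultimately have "h (A * s\<^sup>2, A * s) = \<Phi> (s + \<i> / 2) + \<Psi> (s - \<i> / 2)"
      unfolding h_def \<phi>_def \<psi>_def p(2) q(2) by simp
    also have "\<dots> = F s"
      by (simp add: \<Phi>_def)
    finally show ?thesis by (simp add: F_def x1 x2)
  qed
  ultimately show ?thesis using harm by blast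
qed

end
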